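(* Let $m\ge1$, $n_1,\dots,n_m$ positive integers, $N_i=n_1+\dots+n_i$, and for a sequence $\mathbf k=(k_1,\dots,k_m)$ put $\mathbf k^*=(N_1-k_1+1,\,N_2-k_2+1,\dots,N_m-k_m+1)$. (i) If $k_1<k_2<\dots<k_m$ are positive integers with $k_1\le n_1$, $k_i<k_{i-1}+n_i$ for $1<i<m$, and $k_m\le k_{m-1}+n_m$, then $H_\exists(\mathbf n,\mathbf k)^*=H_\forall(\mathbf n,\mathbf k^* )$. (ii) If $k_1<\dots<k_{m-1}\le k_m$ are positive integers with $k_1\le n_1$ and $k_i<k_{i-1}+n_i$ for $1<i\le m$, then $H_\forall(\mathbf n,\mathbf k)^*=H_\exists(\mathbf n,\mathbf k^* )$.
   Context: Submultisets of $\{1^{n_1},\dots,m^{n_m}\}$ are written $\{1^{\ell_1},\dots,m^{\ell_m}\}$ with $0\le\ell_i\le n_i$; the complement of such a submultiset is $\{1^{n_1-\ell_1},\dots,m^{n_m-\ell_m}\}$. A simple game on the multiset is a nonempty family of winning submultisets closed under taking larger submultisets (componentwise). $H_\exists(\mathbf n,\mathbf k)$ is the game in which $\{1^{\ell_1},\dots,m^{\ell_m}\}$ is winning iff there exists $i$ with $\ell_1+\dots+\ell_i\ge k_i$; $H_\forall(\mathbf n,\mathbf k)$ is the game in which it is winning iff $\ell_1+\dots+\ell_i\ge k_i$ for all $i$. The dual $G^*$ of a game $G$ on the multiset is the game whose winning submultisets are exactly the complements of the losing submultisets of $G$. *)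

theory Defs
  imports Complex_Main "HOL-Library.Multiset"
begin

definition ground :: "nat \<Rightarrow> (nat \<Rightarrow> nat) \<Rightarrow> nat multiset" where
  "ground m n = (\<Sum>i=1..m. replicate_mset (n i) i)"

lemma count_ground: "count (ground m n) j = (if j \<in> {1..m} then n j else 0)"
  by (simp add: ground_def count_sum sum.delta)

text \<open>A game on a multiset is represented by its set of winning submultisets.\<close>

definition simple_game :: "'a multiset \<Rightarrow> 'a multiset set \<Rightarrow> bool" where
  "simple_game M W \<longleftrightarrow>
     W \<subseteq> {X. X \<subseteq># M} \<and> W \<noteq> {} \<and>
     (\<forall>X Y. X \<in> W \<longrightarrow> X \<subseteq># Y \<longrightarrow> Y \<subseteq># M \<longrightarrow> Y \<in> W)"

definition dual_game :: "'a multiset \<Rightarrow> 'a multiset set \<Rightarrow> 'a multiset set" where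
  "dual_game M W = {M - X | X. X \<subseteq># M \<and> X \<notin> W}"

text \<open>
  Thresholds are integers, so that the subtraction in \<open>dual_thresholds\<close> is not truncated.
\<close>

definition H_exists :: "nat \<Rightarrow> (nat \<Rightarrow> nat) \<Rightarrow> (nat \<Rightarrow> int) \<Rightarrow> nat multiset set" where
  "H_exists m n k =
     {X. X \<subseteq># ground m n \<and> (\<exists>i\<in>{1..m}. int (\<Sum>j=1..i. count X j) \<ge> k i)}"

definition H_forall :: "nat \<Rightarrow> (nat \<Rightarrow> nat) \<Rightarrow> (nat \<Rightarrow> int) \<Rightarrow> nat multiset set" where
  "H_forall m n k =
     {X. X \<subseteq># ground m n \<and> (\<forall>i\<in>{1..m}. int (\<Sum>j=1..i. count X j) \<ge> k i)}"

definition dual_thresholds :: "(nat \<Rightarrow> nat) \<Rightarrow> (nat \<Rightarrow> int) \<Rightarrow> nat \<Rightarrow> int" where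
  "dual_thresholds n k i = int (\<Sum>j=1..i. n j) - k i + 1"

text \<open>
  The families above are simple games under hypotheses weaker than those of the duality
  theorem; the dual of a simple game is one provided that the empty multiset is losing.
\<close>

lemma sum_count_mono:
  assumes "X \<subseteq># Y"
  shows "(\<Sum>j=1..i. count X j) \<le> (\<Sum>j=1..i. count Y j)"
  by (intro sum_mono mset_subset_eq_count assms)

lemma sum_count_ground:
  assumes "i \<le> m"
  shows "(\<Sum>j=1..i. count (ground m n) j) = (\<Sum>j=1..i. n j)"
  using assms by (intro sum.cong) (auto simp: count_ground)

lemma simple_game_H_exists:
  assumes "m \<ge> 1" and "k 1 \<le> int (n 1)"
  shows "simple_game (ground m n) (H_exists m n k)"
  unfolding simple_game_def
proof (intro conjI allI impI)
  show "H_exists m n k \<subseteq> {X. X \<subseteq># ground m n}"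
    by (auto simp: H_exists_def)
  have "ground m n \<in> H_exists m n k"
    unfolding H_exists_def using assms by (auto simp: count_ground intro!: bexI[of _ 1])
  then show "H_exists m n k \<noteq> {}" by blast
next
  fix X Y assume X: "X \<in> H_exists m n k" and XY: "X \<subseteq># Y" and Y: "Y \<subseteq># ground m n"
  from X obtain i where i: "i \<in> {1..m}" "k i \<le> int (\<Sum>j=1..i. count X j)"
    by (auto simp: H_exists_def)
  with sum_count_mono[OF XY, of i] have "k i \<le> int (\<Sum>j=1..i. count Y j)" by linarith
  with i(1) Y show "Y \<in> H_exists m n k" unfolding H_exists_def by blast
qed

lemma simple_game_H_forall:
  assumes "\<And>i. i \<in> {1..m} \<Longrightarrow> k i \<le> int (\<Sum>j=1..i. n j)"
  shows "simple_game (ground m n) (H_forall m n k)"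
  unfolding simple_game_def
proof (intro conjI allI impI)
  show "H_forall m n k \<subseteq> {X. X \<subseteq># ground m n}"
    by (auto simp: H_forall_def)
  have "k i \<le> int (\<Sum>j=1..i. count (ground m n) j)" if "i \<in> {1..m}" for i
    using assms[OF that] sum_count_ground[of i m n] that by simp
  then have "ground m n \<in> H_forall m n k"
    unfolding H_forall_def by blast
  then show "H_forall m n k \<noteq> {}" by blast
next
  fix X Y assume X: "X \<in> H_forall m n k" and XY: "X \<subseteq># Y" and Y: "Y \<subseteq># ground m n"
  have "k i \<le> int (\<Sum>j=1..i. count Y j)" if "i \<in> {1..m}" for i
  proof -
    have "k i \<le> int (\<Sum>j=1..i. count X j)" using X that unfolding H_forall_def by blast
    with sum_count_mono[OF XY, of i] show ?thesis by linarith
  qed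
  with Y show "Y \<in> H_forall m n k" unfolding H_forall_def by blast
qed

lemma simple_game_dual_game:
  assumes W: "simple_game M W" and empty: "{#} \<notin> W"
  shows "simple_game M (dual_game M W)"
  unfolding simple_game_def
proof (intro conjI allI impI)
  show "dual_game M W \<subseteq> {X. X \<subseteq># M}" by (auto simp: dual_game_def)
  have "{#} \<subseteq># M" by simp
  then have "M - {#} \<in> dual_game M W" unfolding dual_game_def using empty by blast
  then show "dual_game M W \<noteq> {}" by blast
next
  fix X Y assume X: "X \<in> dual_game M W" and XY: "X \<subseteq># Y" and Y: "Y \<subseteq># M"
  from X obtain Z where Z: "X = M - Z" "Z \<subseteq># M" "Z \<notin> W" by (auto simp: dual_game_def)
  have "M - Y \<subseteq># Z"
    using XY Z(1) by (simp add: subset_eq_diff_conv union_commute)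
  with W Z(2,3) have "M - Y \<notin> W" unfolding simple_game_def by blast
  moreover have "Y = M - (M - Y)" using Y by (simp add: multiset_eq_iff subseteq_mset_def)
  ultimately show "Y \<in> dual_game M W" unfolding dual_game_def using diff_subset_eq_self by blast
qed

end

theory Submission
  imports Defs
begin

text \<open>
  Complementing a submultiset turns each partial sum \<open>s\<close> into \<open>N\<^sub>i - s\<close>, and over the integers
  \<open>N\<^sub>i - s < k\<^sub>i\<close> means \<open>s \<ge> N\<^sub>i - k\<^sub>i + 1\<close>; so dualising is De Morgan's law on the quantifier over \<open>i\<close>.
\<close>

text \<open>Complementation in \<open>M\<close> is an involution on submultisets of
  \<open>M\<close>, so the losing set hidden in the existential of \<open>dual_game\<close> can only
  be \<open>M - Y\<close>.\<close>

lemma mem_dual_game_iff: "Y \<in> dual_game M W \<longleftrightarrow> Y \<subseteq># M \<and> M - Y \<notin> W"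
proof
  assume "Y \<in> dual_game M W"
  then obtain X where "Y = M - X" "X \<subseteq># M" "X \<notin> W"
    by (auto simp: dual_game_def)
  moreover from this have "M - Y = X"
    by (simp add: multiset_eq_iff subseteq_mset_def)
  ultimately show "Y \<subseteq># M \<and> M - Y \<notin> W" by simp
next
  assume Y: "Y \<subseteq># M \<and> M - Y \<notin> W"
  then have "Y = M - (M - Y)"
    by (simp add: multiset_eq_iff subseteq_mset_def)
  with Y show "Y \<in> dual_game M W"
    unfolding dual_game_def using diff_subset_eq_self by blast
qed

lemma sum_count_complement:
  assumes "X \<subseteq># ground m n" and "i \<le> m"
  shows "int (\<Sum>j=1..i. count (ground m n - X) j) =
    int (\<Sum>j=1..i. n j) - int (\<Sum>j=1..i. count X j)"
proof -
  \<comment> \<open>An additive form avoids truncated subtraction on \<open>nat\<close>; termwise it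
    rests on \<open>count X j \<le> count (ground m n) j\<close>, which is the inclusion of
    \<open>X\<close>.\<close>
  have "(\<Sum>j=1..i. count (ground m n - X) j) + (\<Sum>j=1..i. count X j) =
      (\<Sum>j=1..i. count (ground m n) j)"
    unfolding sum.distrib[symmetric]
    using assms(1) by (intro sum.cong) (auto simp: subseteq_mset_def)
  also have "\<dots> = (\<Sum>j=1..i. n j)"
    by (rule sum_count_ground) (rule assms(2))
  finally show ?thesis by linarith
qed

text \<open>Shaped to translate, one index at a time, the losing condition on the complement that
  \<open>mem_dual_game_iff\<close> produces.\<close>

lemma complement_below_threshold_iff:
  assumes "X \<subseteq># ground m n" and "i \<in> {1..m}"
  shows "\<not> k i \<le> int (\<Sum>j=1..i. count (ground m n - X) j) \<longleftrightarrow>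
    dual_thresholds n k i \<le> int (\<Sum>j=1..i. count X j)"
  using sum_count_complement[OF assms(1), of i] assms(2)
  unfolding dual_thresholds_def atLeastAtMost_iff by linarith

lemma dual_game_H_exists:
  "dual_game (ground m n) (H_exists m n k) = H_forall m n (dual_thresholds n k)"
proof (rule set_eqI)
  fix X
  show "X \<in> dual_game (ground m n) (H_exists m n k) \<longleftrightarrow>
      X \<in> H_forall m n (dual_thresholds n k)"
    unfolding mem_dual_game_iff H_exists_def H_forall_def mem_Collect_eq
    \<comment> \<open>The index stays open so that the equivalence applies under the quantifier.
      Since the complement always lies in \<open>ground m n\<close>, losing can only mean that every
      threshold fails.\<close>
    using complement_below_threshold_iff[of X m n _ k]
      diff_subset_eq_self[of "ground m n" X] by blast
qed

lemma dual_game_H_forall: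
  "dual_game (ground m n) (H_forall m n k) = H_exists m n (dual_thresholds n k)"
proof (rule set_eqI)
  fix X
  show "X \<in> dual_game (ground m n) (H_forall m n k) \<longleftrightarrow>
      X \<in> H_exists m n (dual_thresholds n k)"
    unfolding mem_dual_game_iff H_exists_def H_forall_def mem_Collect_eq
    \<comment> \<open>Here losing means that some threshold fails, and that same index witnesses the
      existential game.\<close>
    using complement_below_threshold_iff[of X m n _ k]
      diff_subset_eq_self[of "ground m n" X] by blast
qed

theorem theorem4:
  fixes m :: nat and n :: "nat \<Rightarrow> nat"
  assumes "m \<ge> 1"
    and "\<forall>i\<in>{1..m}. n i > 0"
  shows
    "(\<forall>k :: nat \<Rightarrow> int.
        (\<forall>i\<in>{1..m}. k i > 0) \<and>
        (\<forall>i. 1 \<le> i \<and> i < m \<longrightarrow> k i < k (i + 1)) \<and>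
        k 1 \<le> int (n 1) \<and>
        (\<forall>i. 1 < i \<and> i < m \<longrightarrow> k i < k (i - 1) + int (n i)) \<and>
        (1 < m \<longrightarrow> k m \<le> k (m - 1) + int (n m)) \<longrightarrow>
        dual_game (ground m n) (H_exists m n k) = H_forall m n (dual_thresholds n k)) \<and>
     (\<forall>k :: nat \<Rightarrow> int.
        (\<forall>i\<in>{1..m}. k i > 0) \<and>
        (\<forall>i. 1 \<le> i \<and> i + 1 < m \<longrightarrow> k i < k (i + 1)) \<and>
        (1 < m \<longrightarrow> k (m - 1) \<le> k m) \<and>
        k 1 \<le> int (n 1) \<and>
        (\<forall>i. 1 < i \<and> i \<le> m \<longrightarrow> k i < k (i - 1) + int (n i)) \<longrightarrow>
        dual_game (ground m n) (H_forall m n k) = H_exists m n (dual_thresholds n k))"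
  by (simp only: dual_game_H_exists dual_game_H_forall simp_thms)

end
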